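(* Let $T:X\times W\to X$ be the stochastic system $x_{n+1}=T(x_n,\xi_n)$ with equilibrium point $x=0$ that is locally stochastically asymptotically stable. Assume there exists a Lyapunov measure $\bar\mu$ with constant $\gamma<1$. Then: 1) $x=0$ is almost everywhere almost sure stable with respect to every finite measure $m$ on $X\setminus\{0\}$ that is absolutely continuous with respect to $\bar\mu$. 2) $x=0$ is almost everywhere stochastic stable with geometric decay with respect to every finite measure $m$ on $X\setminus\{0\}$ such that, for some constant $\kappa>0$, $m(B)\le\kappa\,\bar\mu(B)$ for all Borel $B\subset X\setminus\{0\}$.
   Context: Setting. $X\subset\mathbb{R}^d$ is compact with $0\in X$, $\mathcal B(\cdot)$ denotes Borel $\sigma$-algebras, and $\mathcal M(\cdot)$ denotes spaces of finite measures. The random vectors $\xi_0,\xi_1,\dots$ are i.i.d. with values in $W$ and common law $v$. The map $T:X\times W\to X$ is continuous in $x$ and, for each fixed $x$, measurable in $\xi$. The $n$-fold composition is $T^n(x,\xi_0^{n-1})$, i.e. $T^0(x)=x$ and $T^{n+1}(x,\xi_0^{n})=T(T^n(x,\xi_0^{n-1}),\xi_n)$, where $\xi_0^{n-1}=(\xi_0,\dots,\xi_{n-1})$. $U(\epsilon)$ is the $\epsilon$-neighborhood of $0$ in $X$. Equilibrium: $T(0,\xi)=0$ for all $\xi\in W$. Local stability: there is a neighborhood $\mathcal O$ of $0$ such that for all $x_0\in\mathcal O$, $\mathrm{Prob}\{T^n(x_0,\xi_0^{n-1})\in\mathcal O\}=1$ for all $n\ge 0$, and $\mathrm{Prob}\{\lim_{n\to\infty}T^n(x_0,\xi_0^{n-1})=0\}=1$.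 Put $E=\{0\}$, $E^c=X\setminus E$. For a positive measure $\mu$ on $E^c$ and $B\in\mathcal B(E^c)$, $[\mathbb P_1\mu](B)=\int_{E^c}\int_W\chi_B(T(x,y))\,dv(y)\,d\mu(x)$, where $\chi_B$ is the indicator function. Lyapunov measure with constant $\gamma$, $0<\gamma\le 1$: a positive measure $\bar\mu$ on $E^c$ such that for every $\epsilon>0$ it is finite on $X\setminus U(\epsilon)$ and, for all $B\in\mathcal B(X\setminus U(\epsilon))$, $[\mathbb P_1\bar\mu](B)<\gamma\,\bar\mu(B)$ if $\bar\mu(B)>0$, and $[\mathbb P_1\bar\mu](B)=0$ if $\bar\mu(B)=0$. Almost everywhere almost sure stability with respect to $m$: for every $\delta>0$, $m\{x\in X:\mathrm{Prob}\{\lim_{n\to\infty}T^n(x,\xi_0^{n-1})\ne 0\}\ge\delta\}=0$, where "$\lim\neq0$" denotes the event that $T^n(x,\xi_0^{n-1})$ does not converge to $0$. Almost everywhere stochastic stability with geometric decay with respect to $m$: for every $\epsilon>0$ there exist $0<\alpha(\epsilon)<1$, $0<\beta<1$ and $K(\epsilon)<\infty$ such that $m\{x\in X:\mathrm{Prob}\{T^n(x,\xi_0^{n-1})\in B\}\ge\alpha^n\}\le K\beta^n$ for all $n\ge0$ and all $B\in\mathcal B(X\setminus U(\epsilon))$ with $m(B)>0$. Measures $m$ on $E^c$ are regarded as measures on $X$ giving zero mass to $\{0\}$. *)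

theory Defs
  imports "HOL-Probability.Probability"
begin

text \<open>
  The noise space \<open>W\<close> is \<open>space v\<close>, an arbitrary measurable space carrying the common law
  \<open>v\<close> of the noise variables \<open>\<xi> n\<close>, which live on the probability space \<open>M\<close>.
\<close>

locale stochastic_system = prob_space M
  for M :: "'p measure" +
  fixes X :: "'a::euclidean_space set"
    and v :: "'w measure"
    and T :: "'a \<Rightarrow> 'w \<Rightarrow> 'a"
    and \<xi> :: "nat \<Rightarrow> 'p \<Rightarrow> 'w"
  assumes compact_X: "compact X"
    and zero_in_X: "0 \<in> X"
    and indep_noise: "indep_vars (\<lambda>_. v) \<xi> UNIV"
    and law_noise: "\<And>n. distr M v (\<xi> n) = v"
    and T_in_X: "\<And>x w. x \<in> X \<Longrightarrow> w \<in> space v \<Longrightarrow> T x w \<in> X"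
    and T_continuous: "\<And>w. w \<in> space v \<Longrightarrow> continuous_on X (\<lambda>x. T x w)"
    and T_measurable: "\<And>x. x \<in> X \<Longrightarrow> (\<lambda>w. T x w) \<in> borel_measurable v"

text \<open>\<open>iter T n x s\<close> depends only on \<open>s 0, \<dots>, s (n - 1)\<close>.\<close>

primrec iter :: "('a \<Rightarrow> 'w \<Rightarrow> 'a) \<Rightarrow> nat \<Rightarrow> 'a \<Rightarrow> (nat \<Rightarrow> 'w) \<Rightarrow> 'a" where
  "iter T 0 x s = x"
| "iter T (Suc n) x s = T (iter T n x s) (s n)"

definition nbhd0 :: "'a::euclidean_space set \<Rightarrow> real \<Rightarrow> 'a set" where
  "nbhd0 X \<epsilon> = X \<inter> ball 0 \<epsilon>"

definition equilibrium :: "'w measure \<Rightarrow> ('a::zero \<Rightarrow> 'w \<Rightarrow> 'a) \<Rightarrow> bool" where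
  "equilibrium v T \<longleftrightarrow> (\<forall>w\<in>space v. T 0 w = 0)"

text \<open>
  The neighbourhood \<open>N\<close> of \<open>0\<close> in \<open>X\<close> need not be open. If one of the events below is not
  measurable, its \<open>measure\<close> is \<open>0\<close>, so \<open>= 1\<close> also asserts measurability.
\<close>

definition locally_stable ::
  "'p measure \<Rightarrow> 'a::euclidean_space set \<Rightarrow> ('a \<Rightarrow> 'w \<Rightarrow> 'a) \<Rightarrow> (nat \<Rightarrow> 'p \<Rightarrow> 'w) \<Rightarrow> bool" where
  "locally_stable M X T \<xi> \<longleftrightarrow>
    (\<exists>N U. openin (top_of_set X) U \<and> 0 \<in> U \<and> U \<subseteq> N \<and> N \<subseteq> X \<and>
      (\<forall>x\<in>N.
        (\<forall>n. \<P>(\<omega> in M. iter T n x (\<lambda>i. \<xi> i \<omega>) \<in> N) = 1) \<and>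
        \<P>(\<omega> in M. (\<lambda>n. iter T n x (\<lambda>i. \<xi> i \<omega>)) \<longlonglongrightarrow> 0) = 1))"

definition P1 :: "'w measure \<Rightarrow> ('a \<Rightarrow> 'w \<Rightarrow> 'a) \<Rightarrow> 'a measure \<Rightarrow> 'a set \<Rightarrow> ennreal" where
  "P1 v T \<mu> B = (\<integral>\<^sup>+ x. (\<integral>\<^sup>+ y. indicator B (T x y) \<partial>v) \<partial>\<mu>)"

definition lyapunov_measure ::
  "'a::euclidean_space set \<Rightarrow> 'w measure \<Rightarrow> ('a \<Rightarrow> 'w \<Rightarrow> 'a) \<Rightarrow> real \<Rightarrow> 'a measure \<Rightarrow> bool" where
  "lyapunov_measure X v T \<gamma> \<mu> \<longleftrightarrow>
    0 < \<gamma> \<and> \<gamma> \<le> 1 \<and>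
    sets \<mu> = sets (restrict_space borel (X - {0})) \<and>
    (\<forall>\<epsilon>>0.
      emeasure \<mu> (X - nbhd0 X \<epsilon>) < \<infinity> \<and>
      (\<forall>B\<in>sets (restrict_space borel (X - nbhd0 X \<epsilon>)).
        (emeasure \<mu> B > 0 \<longrightarrow> P1 v T \<mu> B < ennreal \<gamma> * emeasure \<mu> B) \<and>
        (emeasure \<mu> B = 0 \<longrightarrow> P1 v T \<mu> B = 0)))"

text \<open>
  A measure \<open>m\<close> on \<open>X - {0}\<close> regarded as a measure on \<open>X\<close> without mass at \<open>0\<close>:
  the image of \<open>m\<close> under the inclusion map.
\<close>

definition extend_by_zero :: "'a::euclidean_space set \<Rightarrow> 'a measure \<Rightarrow> 'a measure" where
  "extend_by_zero X m = distr m (restrict_space borel X) (\<lambda>x. x)"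

text \<open>
  In the two stability notions \<open>m\<close> is a measure on the Borel sets of \<open>X\<close>. As \<open>emeasure\<close>
  is \<open>0\<close> outside \<open>sets m\<close>, measurability of the sets of initial points is part of both.
\<close>

definition ae_as_stable ::
  "'p measure \<Rightarrow> 'a::euclidean_space set \<Rightarrow> ('a \<Rightarrow> 'w \<Rightarrow> 'a) \<Rightarrow> (nat \<Rightarrow> 'p \<Rightarrow> 'w) \<Rightarrow>
   'a measure \<Rightarrow> bool" where
  "ae_as_stable M X T \<xi> m \<longleftrightarrow>
    (\<forall>\<delta>>0.
      {x\<in>X. \<P>(\<omega> in M. \<not> (\<lambda>n. iter T n x (\<lambda>i. \<xi> i \<omega>)) \<longlonglongrightarrow> 0) \<ge> \<delta>} \<in> null_sets m)"

definition ae_stochastic_stable_geometric ::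
  "'p measure \<Rightarrow> 'a::euclidean_space set \<Rightarrow> ('a \<Rightarrow> 'w \<Rightarrow> 'a) \<Rightarrow> (nat \<Rightarrow> 'p \<Rightarrow> 'w) \<Rightarrow>
   'a measure \<Rightarrow> bool" where
  "ae_stochastic_stable_geometric M X T \<xi> m \<longleftrightarrow>
    (\<forall>\<epsilon>>0. \<exists>\<alpha> \<beta> K :: real. 0 < \<alpha> \<and> \<alpha> < 1 \<and> 0 < \<beta> \<and> \<beta> < 1 \<and>
      (\<forall>n. \<forall>B\<in>sets (restrict_space borel (X - nbhd0 X \<epsilon>)). emeasure m B > 0 \<longrightarrow>
        (let S = {x\<in>X. \<P>(\<omega> in M. iter T n x (\<lambda>i. \<xi> i \<omega>) \<in> B) \<ge> \<alpha> ^ n}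
         in S \<in> sets m \<and> emeasure m S \<le> ennreal (K * \<beta> ^ n))))"

end

theory Submission
  imports Defs
begin

text \<open>
  Let \<open>\<nu>\<close> be the Lyapunov measure, regarded as a measure on \<open>X\<close> without mass at \<open>0\<close>, and let
  \<open>K f x = \<integral> f (T x w) dv(w)\<close> be the Koopman operator. The Lyapunov inequality gives
  \<open>\<integral> K f d\<nu> \<le> \<gamma> \<integral> f d\<nu>\<close> for the indicator \<open>f\<close> of a Borel set that stays away from \<open>0\<close>. Monotone
  convergence extends this to Borel sets that merely omit \<open>0\<close> (\<open>lyapunov_contraction\<close>), and then to
  every measurable \<open>f \<ge> 0\<close> with \<open>f 0 = 0\<close> (\<open>koopman_contraction_of_sets\<close>). Because \<open>0\<close> is an
  equilibrium, \<open>K\<close> maps this class of functions to itself, so the inequality can be iterated. As the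
  noise is i.i.d., \<open>E f(T\<^sup>n\<^sup>+\<^sup>1 x) = E (K f)(T\<^sup>n x)\<close> (\<open>expectation_iter_Suc\<close>), and together these give the
  key estimate \<open>expectation_decay\<close>:

  \<open>\<integral> E f(T\<^sup>n x) d\<nu>(x) \<le> \<gamma>\<^sup>n \<integral> f d\<nu>\<close>.

  Both claims come from taking for \<open>f\<close> the indicator of a set outside \<open>U(\<epsilon>)\<close>, where \<open>\<nu>\<close> is finite.

  \<^item> Summing over \<open>n\<close>, the geometric series shows that for \<open>\<nu>\<close>-almost every \<open>x\<close> the probabilities of
    \<open>T\<^sup>n x \<notin> U(\<epsilon>)\<close> are summable. By Borel and Cantelli the trajectory almost surely stays in \<open>U(\<epsilon>)\<close>
    from some time on. A sequence of radii tending to \<open>0\<close> gives almost sure convergence to \<open>0\<close> for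
    \<open>\<nu>\<close>-almost every \<open>x\<close> (\<open>AE_convergence\<close>), and null sets pass to \<open>m\<close> by absolute continuity.

  \<^item> Markov's inequality with threshold \<open>\<alpha>\<^sup>n\<close> bounds the \<open>\<nu>\<close>-measure of the points that visit \<open>B\<close> at
    time \<open>n\<close> with probability at least \<open>\<alpha>\<^sup>n\<close> by \<open>(\<gamma>/\<alpha>)\<^sup>n \<nu>(X - U(\<epsilon>))\<close>. The choice \<open>\<alpha> = \<surd>\<gamma>\<close> makes both
    rates smaller than \<open>1\<close>, and domination by \<open>\<kappa> \<nu>\<close> carries the bound over to \<open>m\<close>
    (\<open>geometric_decay_of_domination\<close>).

  All this rests on the measurability of \<open>x \<mapsto> E f(T\<^sup>n x)\<close>. The map \<open>T\<close> is only continuous in \<open>x\<close> and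
  measurable in the noise, but this makes it jointly measurable
  (\<open>caratheodory_jointly_measurable\<close>).
\<close>

section \<open>Joint measurability of Caratheodory functions\<close>

text \<open>
  Replacing the first argument by the first point of a countable dense sequence that is close
  enough to it gives a function that is measurable piece by piece, on countably many pieces. By
  continuity these functions converge pointwise to \<open>f\<close>.
\<close>

lemma caratheodory_jointly_measurable:
  fixes f :: "'a::{metric_space, second_countable_topology} \<Rightarrow> 'w \<Rightarrow> 'b::metric_space"
  assumes cont: "\<And>w. w \<in> space v \<Longrightarrow> continuous_on S (\<lambda>x. f x w)"
    and meas: "\<And>x. x \<in> S \<Longrightarrow> f x \<in> borel_measurable v"
  shows "(\<lambda>p. f (fst p) (snd p)) \<in> borel_measurable (restrict_space borel S \<Otimes>\<^sub>M v)"
proof (cases "S = {}")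
  case True
  then have "space (restrict_space borel S \<Otimes>\<^sub>M v) = {}"
    by (simp add: space_pair_measure space_restrict_space)
  then show ?thesis
    by (auto simp: measurable_def)
next
  case False
  let ?S = "restrict_space borel S"
  obtain D where D: "countable D" "D \<subseteq> S" "S \<subseteq> closure D"
    using separable by blast
  with False have "D \<noteq> {}"
    by auto
  define d where "d = from_nat_into D"
  have d: "d i \<in> S" for i
    using D(2) from_nat_into[OF \<open>D \<noteq> {}\<close>] by (auto simp: d_def)
  have dense: "\<exists>i. dist (d i) x < e" if x: "x \<in> S" and e: "e > 0" for x e
  proof -
    obtain y where "y \<in> D" "dist y x < e"
      using subsetD[OF D(3) x] e by (auto simp: closure_approachable)
    then show ?thesis
      by (metis d_def D(1) from_nat_into_surj)
  qed
  \<comment> \<open>\<open>d (j k x)\<close> is the first point of the dense sequence within \<open>1 / (k + 1)\<close> of \<open>x\<close>.\<close>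
  define j where "j k x = (LEAST i. dist (d i) x < inverse (real (Suc k)))" for k x
  have j: "dist (d (j k x)) x < inverse (real (Suc k))" if "x \<in> S" for k x
    unfolding j_def using dense[OF that, of "inverse (real (Suc k))"] by (auto intro: LeastI_ex)
  have j_meas: "j k \<in> ?S \<rightarrow>\<^sub>M count_space UNIV" for k
  proof -
    have [measurable]: "(\<lambda>x. x) \<in> borel_measurable ?S"
      by (rule measurable_restrict_space1) simp
    show ?thesis
      unfolding j_def by measurable
  qed
  show ?thesis
  proof (rule borel_measurable_LIMSEQ_metric)
    fix k
    show "(\<lambda>p. f (d (j k (fst p))) (snd p)) \<in> borel_measurable (?S \<Otimes>\<^sub>M v)"
    proof (rule measurable_compose_countable[where f="\<lambda>i p. f (d i) (snd p)" and g="\<lambda>p. j k (fst p)"])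
      show "(\<lambda>p. f (d i) (snd p)) \<in> borel_measurable (?S \<Otimes>\<^sub>M v)" for i
        by (rule measurable_compose[OF measurable_snd meas[OF d]])
      show "(\<lambda>p. j k (fst p)) \<in> (?S \<Otimes>\<^sub>M v) \<rightarrow>\<^sub>M count_space UNIV"
        by (rule measurable_compose[OF measurable_fst j_meas])
    qed
  next
    fix p assume "p \<in> space (?S \<Otimes>\<^sub>M v)"
    then have p: "fst p \<in> S" "snd p \<in> space v"
      by (auto simp: space_pair_measure space_restrict_space)
    have "(\<lambda>k. dist (d (j k (fst p))) (fst p)) \<longlonglongrightarrow> 0"
      by (rule tendsto_sandwich[OF _ _ tendsto_const LIMSEQ_inverse_real_of_nat])
        (auto intro!: always_eventually less_imp_le j p simp del: of_nat_Suc)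
    then have "(\<lambda>k. d (j k (fst p))) \<longlonglongrightarrow> fst p"
      by (rule tendsto_dist_iff[THEN iffD2])
    then show "(\<lambda>k. f (d (j k (fst p))) (snd p)) \<longlonglongrightarrow> f (fst p) (snd p)"
      by (rule continuous_on_tendsto_compose[OF cont[OF p(2)]]) (simp_all add: p d)
  qed
qed

section \<open>The Koopman operator and the law of the trajectory\<close>

lemma iter_cong: "(\<And>i. i < n \<Longrightarrow> s i = s' i) \<Longrightarrow> iter T n x s = iter T n x s'"
  by (induction n) auto

text \<open>
  This operator on functions is dual to the action of the system on measures: \<open>P1 v T \<mu> B\<close> is the
  integral of \<open>koopman v T (indicator B)\<close> with respect to \<open>\<mu>\<close>. Values in \<^typ>\<open>ennreal\<close> make all
  integrals exist.
\<close>

definition koopman :: "'w measure \<Rightarrow> ('a \<Rightarrow> 'w \<Rightarrow> 'a) \<Rightarrow> ('a \<Rightarrow> ennreal) \<Rightarrow> 'a \<Rightarrow> ennreal" where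
  "koopman v T f x = (\<integral>\<^sup>+ w. f (T x w) \<partial>v)"

context stochastic_system
begin

abbreviation BX :: "'a measure" where
  "BX \<equiv> restrict_space borel X"

lemma space_BX: "space BX = X"
  by (simp add: space_restrict_space)

lemma sets_BX_iff: "A \<in> sets BX \<longleftrightarrow> A \<subseteq> X \<and> A \<in> sets borel"
  using compact_X by (simp add: sets_restrict_space_iff borel_closed compact_imp_closed)

lemma noise_measurable: "\<xi> n \<in> M \<rightarrow>\<^sub>M v"
  using indep_noise by (simp add: indep_vars_def)

lemma prob_space_v: "prob_space v"
  using prob_space_distr[OF noise_measurable[of 0]] by (simp add: law_noise)

lemma T_jointly_measurable: "(\<lambda>p. T (fst p) (snd p)) \<in> BX \<Otimes>\<^sub>M v \<rightarrow>\<^sub>M BX"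
proof (rule measurable_restrict_space2)
  show "(\<lambda>p. T (fst p) (snd p)) \<in> space (BX \<Otimes>\<^sub>M v) \<rightarrow> X"
    by (auto simp: space_pair_measure space_BX T_in_X)
  show "(\<lambda>p. T (fst p) (snd p)) \<in> borel_measurable (BX \<Otimes>\<^sub>M v)"
    by (intro caratheodory_jointly_measurable T_continuous T_measurable)
qed

text \<open>
  The index set is a parameter because the noise sequence is used both with all coordinates and
  with only the finitely many that matter.
\<close>

lemma iter_jointly_measurable:
  assumes "{..<n} \<subseteq> I"
  shows "(\<lambda>p. iter T n (fst p) (snd p)) \<in> BX \<Otimes>\<^sub>M PiM I (\<lambda>_. v) \<rightarrow>\<^sub>M BX"
  using assms
proof (induction n)
  case (Suc n)
  have "(\<lambda>p. (iter T n (fst p) (snd p), snd p n)) \<in> BX \<Otimes>\<^sub>M PiM I (\<lambda>_. v) \<rightarrow>\<^sub>M BX \<Otimes>\<^sub>M v"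
  proof (rule measurable_Pair)
    show "(\<lambda>p. iter T n (fst p) (snd p)) \<in> BX \<Otimes>\<^sub>M PiM I (\<lambda>_. v) \<rightarrow>\<^sub>M BX"
      using Suc by (simp add: lessThan_Suc)
    show "(\<lambda>p. snd p n) \<in> BX \<Otimes>\<^sub>M PiM I (\<lambda>_. v) \<rightarrow>\<^sub>M v"
      using Suc.prems by (intro measurable_compose[OF measurable_snd] measurable_component_singleton) auto
  qed
  from measurable_compose[OF this T_jointly_measurable] show ?case
    by simp
qed simp

lemma trajectory_jointly_measurable:
  "(\<lambda>p. iter T n (fst p) (\<lambda>i. \<xi> i (snd p))) \<in> BX \<Otimes>\<^sub>M M \<rightarrow>\<^sub>M BX"
proof -
  have "(\<lambda>\<omega> i. \<xi> i \<omega>) \<in> M \<rightarrow>\<^sub>M PiM UNIV (\<lambda>_. v)"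
    by (rule measurable_PiM_single') (auto intro: noise_measurable measurable_space[OF noise_measurable])
  then have "(\<lambda>p. (fst p, \<lambda>i. \<xi> i (snd p))) \<in> BX \<Otimes>\<^sub>M M \<rightarrow>\<^sub>M BX \<Otimes>\<^sub>M PiM UNIV (\<lambda>_. v)"
    by (intro measurable_Pair measurable_fst measurable_compose[OF measurable_snd])
  from measurable_compose[OF this iter_jointly_measurable[of n UNIV]] show ?thesis
    by simp
qed

lemma trajectory_measurable:
  assumes "x \<in> X"
  shows "(\<lambda>\<omega>. iter T n x (\<lambda>i. \<xi> i \<omega>)) \<in> M \<rightarrow>\<^sub>M BX"
  using measurable_compose[OF measurable_Pair1' trajectory_jointly_measurable, of x n] assms
  by (simp add: space_BX)

lemma expectation_trajectory_measurable:
  assumes "f \<in> borel_measurable BX"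
  shows "(\<lambda>x. \<integral>\<^sup>+ \<omega>. f (iter T n x (\<lambda>i. \<xi> i \<omega>)) \<partial>M) \<in> borel_measurable BX"
  using measurable_compose[OF trajectory_jointly_measurable assms]
  by (intro borel_measurable_nn_integral) (simp add: case_prod_beta')

lemma koopman_measurable:
  assumes "f \<in> borel_measurable BX"
  shows "koopman v T f \<in> borel_measurable BX"
proof -
  interpret v: prob_space v
    by (rule prob_space_v)
  show ?thesis
    unfolding koopman_def using measurable_compose[OF T_jointly_measurable assms]
    by (intro v.borel_measurable_nn_integral) (simp add: case_prod_beta')
qed

text \<open>
  The functions vanishing at \<open>0\<close> form the class on which the Lyapunov inequality contracts. That it is
  invariant is where the equilibrium property enters.
\<close>

lemma koopman_zero:
  assumes "equilibrium v T" "f 0 = 0"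
  shows "koopman v T f 0 = 0"
  using assms by (simp add: koopman_def equilibrium_def nn_integral_0_iff_AE cong: nn_integral_cong)

text \<open>
  By independence and the common law, the first \<open>n\<close> noise variables are distributed as a finite
  product, on which the coordinates can be integrated one at a time.
\<close>

lemma expectation_trajectory_eq_PiM:
  assumes x: "x \<in> X" and f: "f \<in> borel_measurable BX"
  shows "(\<integral>\<^sup>+ \<omega>. f (iter T n x (\<lambda>i. \<xi> i \<omega>)) \<partial>M)
       = (\<integral>\<^sup>+ s. f (iter T n x s) \<partial>(PiM {..<n} (\<lambda>_. v)))"
proof (cases "n = 0")
  case True
  interpret P: prob_space "PiM {..<n} (\<lambda>_. v)"
    by (intro prob_space_PiM prob_space_v)
  show ?thesis
    using True P.emeasure_space_1 by (simp add: emeasure_space_1)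
next
  case False
  let ?r = "\<lambda>\<omega>. \<lambda>i\<in>{..<n}. \<xi> i \<omega>"
  have "indep_vars (\<lambda>_. v) \<xi> {..<n}"
    using indep_noise by (rule indep_vars_subset) simp
  then have law: "distr M (PiM {..<n} (\<lambda>_. v)) ?r = PiM {..<n} (\<lambda>_. v)"
    using False by (subst (asm) indep_vars_iff_distr_eq_PiM) (auto simp: law_noise noise_measurable)
  have r: "?r \<in> M \<rightarrow>\<^sub>M PiM {..<n} (\<lambda>_. v)"
    by (intro measurable_restrict noise_measurable)
  have "(\<lambda>s. iter T n x s) \<in> PiM {..<n} (\<lambda>_. v) \<rightarrow>\<^sub>M BX"
    using measurable_compose[OF measurable_Pair1' iter_jointly_measurable[OF subset_refl], of x n] x
    by (simp add: space_BX)
  then have "(\<lambda>s. f (iter T n x s)) \<in> borel_measurable (PiM {..<n} (\<lambda>_. v))"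
    using f by (rule measurable_compose)
  then have "(\<integral>\<^sup>+ s. f (iter T n x s) \<partial>(PiM {..<n} (\<lambda>_. v))) = (\<integral>\<^sup>+ \<omega>. f (iter T n x (?r \<omega>)) \<partial>M)"
    using nn_integral_distr[OF r, of "\<lambda>s. f (iter T n x s)"] by (simp add: law)
  also have "\<dots> = (\<integral>\<^sup>+ \<omega>. f (iter T n x (\<lambda>i. \<xi> i \<omega>)) \<partial>M)"
    by (intro nn_integral_cong arg_cong[of _ _ f] iter_cong) simp
  finally show ?thesis ..
qed

text \<open>
  The Markov property: \<open>T\<^sup>n x\<close> depends only on the first \<open>n\<close> noise variables, so the last one can be
  integrated out first, by Fubini's theorem on the finite product.
\<close>

lemma expectation_iter_Suc:
  assumes x: "x \<in> X" and f: "f \<in> borel_measurable BX"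
  shows "(\<integral>\<^sup>+ \<omega>. f (iter T (Suc n) x (\<lambda>i. \<xi> i \<omega>)) \<partial>M)
       = (\<integral>\<^sup>+ \<omega>. koopman v T f (iter T n x (\<lambda>i. \<xi> i \<omega>)) \<partial>M)"
proof -
  interpret v: prob_space v
    by (rule prob_space_v)
  interpret product_sigma_finite "\<lambda>_::nat. v"
    by standard
  have "(\<lambda>s. iter T (Suc n) x s) \<in> PiM {..<Suc n} (\<lambda>_. v) \<rightarrow>\<^sub>M BX"
    using measurable_compose[OF measurable_Pair1' iter_jointly_measurable[OF subset_refl], of x "Suc n"] x
    by (simp add: space_BX)
  then have meas: "(\<lambda>s. f (iter T (Suc n) x s)) \<in> borel_measurable (PiM (insert n {..<n}) (\<lambda>_. v))"
    using measurable_compose[OF _ f] by (simp add: lessThan_Suc)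
  have "(\<integral>\<^sup>+ \<omega>. f (iter T (Suc n) x (\<lambda>i. \<xi> i \<omega>)) \<partial>M)
      = (\<integral>\<^sup>+ s. f (iter T (Suc n) x s) \<partial>(PiM (insert n {..<n}) (\<lambda>_. v)))"
    using expectation_trajectory_eq_PiM[OF x f, of "Suc n"] by (simp only: lessThan_Suc)
  also have "\<dots> = (\<integral>\<^sup>+ s. \<integral>\<^sup>+ w. f (iter T (Suc n) x (s(n := w))) \<partial>v \<partial>(PiM {..<n} (\<lambda>_. v)))"
    by (rule product_nn_integral_insert[OF _ _ meas]) auto
  also have "\<dots> = (\<integral>\<^sup>+ s. koopman v T f (iter T n x s) \<partial>(PiM {..<n} (\<lambda>_. v)))"
  proof -
    have "iter T n x (s(n := w)) = iter T n x s" for s w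
      by (rule iter_cong) simp
    then show ?thesis
      by (simp add: koopman_def)
  qed
  also have "\<dots> = (\<integral>\<^sup>+ \<omega>. koopman v T f (iter T n x (\<lambda>i. \<xi> i \<omega>)) \<partial>M)"
    by (rule expectation_trajectory_eq_PiM[OF x koopman_measurable[OF f], symmetric])
  finally show ?thesis .
qed

section \<open>Decay of expectations from contraction on sets\<close>

text \<open>
  The standard extension from indicators to nonnegative measurable functions. The condition at \<open>0\<close>
  survives it, because a nonnegative combination or a supremum of nonnegative functions vanishes at
  \<open>0\<close> only if the constituents do, except for those with coefficient zero.
\<close>

lemma koopman_contraction_of_sets:
  assumes \<nu>: "sets \<nu> = sets BX"
    and contr: "\<And>B. B \<in> sets BX \<Longrightarrow> 0 \<notin> B \<Longrightarrow>
      (\<integral>\<^sup>+ x. koopman v T (indicator B) x \<partial>\<nu>) \<le> c * emeasure \<nu> B"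
    and f: "f \<in> borel_measurable BX" and f0: "f 0 = 0"
  shows "(\<integral>\<^sup>+ x. koopman v T f x \<partial>\<nu>) \<le> c * (\<integral>\<^sup>+ x. f x \<partial>\<nu>)"
proof -
  interpret v: prob_space v
    by (rule prob_space_v)
  have meas_\<nu>: "borel_measurable \<nu> = borel_measurable BX"
    by (rule measurable_cong_sets[OF \<nu> refl])
  have space_\<nu>: "space \<nu> = X"
    using sets_eq_imp_space_eq[OF \<nu>] by (simp add: space_BX)
  have T_section: "(\<lambda>w. g (T x w)) \<in> borel_measurable v"
    if "g \<in> borel_measurable BX" "x \<in> X" for g :: "'a \<Rightarrow> ennreal" and x
    using measurable_compose[OF measurable_Pair1'
        measurable_compose[OF T_jointly_measurable that(1)], of x] that(2)
    by (simp add: space_BX)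
  show ?thesis
    using f f0
  proof (induction f rule: borel_measurable_induct)
    case (cong f g)
    have "(\<integral>\<^sup>+ x. koopman v T f x \<partial>\<nu>) = (\<integral>\<^sup>+ x. koopman v T g x \<partial>\<nu>)"
      unfolding koopman_def using cong(3)
      by (intro nn_integral_cong) (simp add: T_in_X space_BX space_\<nu>)
    moreover have "(\<integral>\<^sup>+ x. f x \<partial>\<nu>) = (\<integral>\<^sup>+ x. g x \<partial>\<nu>)"
      using cong(3) by (intro nn_integral_cong) (simp add: space_BX space_\<nu>)
    moreover have "g 0 = 0"
      using cong(3)[of 0] cong.prems zero_in_X by (simp add: space_BX)
    ultimately show ?case
      using cong(4) by simp
  next
    case (set A)
    then have "0 \<notin> A"
      by (auto simp: indicator_def split: if_splits)
    with set(1) contr[of A] \<nu> show ?case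
      by simp
  next
    case (mult u a)
    show ?case
    proof (cases "a = 0")
      case True
      then show ?thesis
        by (simp add: koopman_def)
    next
      case False
      with mult.prems have "u 0 = 0"
        by simp
      have "(\<integral>\<^sup>+ x. koopman v T (\<lambda>x. a * u x) x \<partial>\<nu>) = (\<integral>\<^sup>+ x. a * koopman v T u x \<partial>\<nu>)"
        unfolding koopman_def
        by (intro nn_integral_cong nn_integral_cmult T_section mult(2)) (simp add: space_\<nu>)
      also have "\<dots> = a * (\<integral>\<^sup>+ x. koopman v T u x \<partial>\<nu>)"
        using koopman_measurable[OF mult(2)] by (intro nn_integral_cmult) (simp add: meas_\<nu>)
      also have "\<dots> \<le> a * (c * (\<integral>\<^sup>+ x. u x \<partial>\<nu>))"
        by (intro mult_left_mono mult.IH \<open>u 0 = 0\<close>) simp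
      also have "\<dots> = c * (\<integral>\<^sup>+ x. a * u x \<partial>\<nu>)"
        using mult(2) by (simp add: nn_integral_cmult meas_\<nu> ac_simps)
      finally show ?thesis .
    qed
  next
    case (add u w)
    have zero: "u 0 = 0" "w 0 = 0"
      using add.prems by simp_all
    have "(\<integral>\<^sup>+ x. koopman v T (\<lambda>x. w x + u x) x \<partial>\<nu>)
        = (\<integral>\<^sup>+ x. koopman v T w x + koopman v T u x \<partial>\<nu>)"
      unfolding koopman_def
      by (intro nn_integral_cong nn_integral_add T_section add(1,3)) (simp_all add: space_\<nu>)
    also have "\<dots> = (\<integral>\<^sup>+ x. koopman v T w x \<partial>\<nu>) + (\<integral>\<^sup>+ x. koopman v T u x \<partial>\<nu>)"
      using koopman_measurable[OF add(1)] koopman_measurable[OF add(3)]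
      by (intro nn_integral_add) (simp_all add: meas_\<nu>)
    also have "\<dots> \<le> c * (\<integral>\<^sup>+ x. w x \<partial>\<nu>) + c * (\<integral>\<^sup>+ x. u x \<partial>\<nu>)"
      by (intro add_mono add.IH zero)
    also have "\<dots> = c * (\<integral>\<^sup>+ x. w x + u x \<partial>\<nu>)"
      using add(1,3) by (simp add: nn_integral_add meas_\<nu> distrib_left)
    finally show ?case .
  next
    case (seq U)
    have zero: "U i 0 = 0" for i
    proof -
      have "U i 0 \<le> (SUP i. U i) 0"
        by (auto simp: image_comp intro: SUP_upper)
      with seq.prems show ?thesis
        by simp
    qed
    have mono: "incseq (\<lambda>i. koopman v T (U i))"
      unfolding koopman_def using \<open>incseq U\<close>
      by (auto simp: incseq_def le_fun_def intro!: nn_integral_mono)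
    have sup: "koopman v T (SUP i. U i) x = (SUP i. koopman v T (U i) x)" if "x \<in> X" for x
    proof -
      have "(\<integral>\<^sup>+ w. (SUP i. U i (T x w)) \<partial>v) = (SUP i. (\<integral>\<^sup>+ w. U i (T x w) \<partial>v))"
        using \<open>incseq U\<close> that seq(1)
        by (intro nn_integral_monotone_convergence_SUP T_section) (auto simp: incseq_def le_fun_def)
      then show ?thesis
        by (simp add: koopman_def image_comp)
    qed
    have "(\<integral>\<^sup>+ x. koopman v T (SUP i. U i) x \<partial>\<nu>) = (\<integral>\<^sup>+ x. (SUP i. koopman v T (U i) x) \<partial>\<nu>)"
      by (intro nn_integral_cong sup) (simp add: space_\<nu>)
    also have "\<dots> = (SUP i. \<integral>\<^sup>+ x. koopman v T (U i) x \<partial>\<nu>)"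
      using mono koopman_measurable[OF seq(1)]
      by (intro nn_integral_monotone_convergence_SUP) (auto simp: meas_\<nu>)
    also have "\<dots> \<le> c * (\<integral>\<^sup>+ x. (SUP i. U i) x \<partial>\<nu>)"
      by (intro SUP_least order_trans[OF seq.IH[OF zero]] mult_left_mono nn_integral_mono)
        (auto simp: image_comp intro: SUP_upper)
    finally show ?case .
  qed
qed

lemma expectation_decay:
  assumes eq: "equilibrium v T"
    and \<nu>: "sets \<nu> = sets BX"
    and contr: "\<And>B. B \<in> sets BX \<Longrightarrow> 0 \<notin> B \<Longrightarrow>
      (\<integral>\<^sup>+ x. koopman v T (indicator B) x \<partial>\<nu>) \<le> c * emeasure \<nu> B"
    and f: "f \<in> borel_measurable BX" and f0: "f 0 = 0"
  shows "(\<integral>\<^sup>+ x. \<integral>\<^sup>+ \<omega>. f (iter T n x (\<lambda>i. \<xi> i \<omega>)) \<partial>M \<partial>\<nu>) \<le> c ^ n * (\<integral>\<^sup>+ x. f x \<partial>\<nu>)"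
  using f f0
proof (induction n arbitrary: f)
  case 0
  then show ?case
    by (simp add: emeasure_space_1)
next
  case (Suc n)
  have space_\<nu>: "space \<nu> = X"
    using sets_eq_imp_space_eq[OF \<nu>] by (simp add: space_BX)
  have "(\<integral>\<^sup>+ x. \<integral>\<^sup>+ \<omega>. f (iter T (Suc n) x (\<lambda>i. \<xi> i \<omega>)) \<partial>M \<partial>\<nu>)
      = (\<integral>\<^sup>+ x. \<integral>\<^sup>+ \<omega>. koopman v T f (iter T n x (\<lambda>i. \<xi> i \<omega>)) \<partial>M \<partial>\<nu>)"
    by (intro nn_integral_cong expectation_iter_Suc Suc.prems) (simp add: space_\<nu>)
  also have "\<dots> \<le> c ^ n * (\<integral>\<^sup>+ x. koopman v T f x \<partial>\<nu>)"
    by (intro Suc.IH koopman_measurable koopman_zero eq Suc.prems)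
  also have "\<dots> \<le> c ^ n * (c * (\<integral>\<^sup>+ x. f x \<partial>\<nu>))"
    by (intro mult_left_mono koopman_contraction_of_sets[OF \<nu> contr] Suc.prems) auto
  finally show ?case
    by (simp add: ac_simps)
qed

section \<open>Almost sure convergence\<close>

lemma prob_trajectory_in:
  assumes "x \<in> X" "B \<in> sets BX"
  shows "(\<integral>\<^sup>+ \<omega>. indicator B (iter T n x (\<lambda>i. \<xi> i \<omega>)) \<partial>M)
       = ennreal (\<P>(\<omega> in M. iter T n x (\<lambda>i. \<xi> i \<omega>) \<in> B))"
proof -
  have "{\<omega> \<in> space M. iter T n x (\<lambda>i. \<xi> i \<omega>) \<in> B} \<in> sets M"
    using measurable_sets[OF trajectory_measurable[OF assms(1)] assms(2), of n]
    by (simp add: vimage_def Int_def conj_commute)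
  then have "(\<integral>\<^sup>+ \<omega>. indicator {\<omega> \<in> space M. iter T n x (\<lambda>i. \<xi> i \<omega>) \<in> B} \<omega> \<partial>M)
       = emeasure M {\<omega> \<in> space M. iter T n x (\<lambda>i. \<xi> i \<omega>) \<in> B}"
    by (rule nn_integral_indicator)
  also have "(\<integral>\<^sup>+ \<omega>. indicator {\<omega> \<in> space M. iter T n x (\<lambda>i. \<xi> i \<omega>) \<in> B} \<omega> \<partial>M)
      = (\<integral>\<^sup>+ \<omega>. indicator B (iter T n x (\<lambda>i. \<xi> i \<omega>)) \<partial>M)"
    by (intro nn_integral_cong) (auto simp: indicator_def)
  finally show ?thesis
    by (simp add: emeasure_eq_measure)
qed

lemma outside_nbhd0_measurable: "X - nbhd0 X \<epsilon> \<in> sets BX"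
proof -
  have "X - nbhd0 X \<epsilon> = X - ball 0 \<epsilon>"
    by (auto simp: nbhd0_def)
  moreover have "X - ball 0 \<epsilon> \<in> sets borel"
    using compact_X by (intro borel_closed closed_Diff compact_imp_closed) auto
  ultimately show ?thesis
    by (auto simp: sets_BX_iff)
qed

text \<open>
  Borel-Cantelli for almost every initial point: the expected number of visits to \<open>X - U(\<epsilon>)\<close>,
  integrated over all initial points, is at most \<open>\<nu>(X - U(\<epsilon>)) / (1 - c)\<close> and hence finite.
\<close>

lemma AE_convergence:
  assumes eq: "equilibrium v T"
    and \<nu>: "sets \<nu> = sets BX"
    and contr: "\<And>B. B \<in> sets BX \<Longrightarrow> 0 \<notin> B \<Longrightarrow>
      (\<integral>\<^sup>+ x. koopman v T (indicator B) x \<partial>\<nu>) \<le> ennreal c * emeasure \<nu> B"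
    and c: "0 \<le> c" "c < 1"
    and fin: "\<And>\<epsilon>. \<epsilon> > 0 \<Longrightarrow> emeasure \<nu> (X - nbhd0 X \<epsilon>) < \<infinity>"
  shows "AE x in \<nu>. AE \<omega> in M. (\<lambda>n. iter T n x (\<lambda>i. \<xi> i \<omega>)) \<longlonglongrightarrow> 0"
proof -
  have meas_\<nu>: "borel_measurable \<nu> = borel_measurable BX"
    by (rule measurable_cong_sets[OF \<nu> refl])
  have space_\<nu>: "space \<nu> = X"
    using sets_eq_imp_space_eq[OF \<nu>] by (simp add: space_BX)
  have AE_eventually: "AE x in \<nu>. AE \<omega> in M.
      eventually (\<lambda>n. iter T n x (\<lambda>i. \<xi> i \<omega>) \<notin> X - nbhd0 X \<epsilon>) sequentially" if "\<epsilon> > 0" for \<epsilon>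
  proof -
    let ?A = "X - nbhd0 X \<epsilon>"
    let ?p = "\<lambda>n x. \<integral>\<^sup>+ \<omega>. indicator ?A (iter T n x (\<lambda>i. \<xi> i \<omega>)) \<partial>M"
    have A: "?A \<in> sets BX" "0 \<notin> ?A"
      using outside_nbhd0_measurable that by (auto simp: nbhd0_def)
    have p: "?p n \<in> borel_measurable \<nu>" for n
      unfolding meas_\<nu> using A(1) by (intro expectation_trajectory_measurable) simp
    have "(\<integral>\<^sup>+ x. (\<Sum>n. ?p n x) \<partial>\<nu>) = (\<Sum>n. \<integral>\<^sup>+ x. ?p n x \<partial>\<nu>)"
      by (intro nn_integral_suminf p)
    also have "\<dots> \<le> (\<Sum>n. ennreal c ^ n * (\<integral>\<^sup>+ x. indicator ?A x \<partial>\<nu>))"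
      using A by (intro suminf_le expectation_decay[OF eq \<nu> contr]) auto
    also have "\<dots> = ennreal (\<Sum>n. c ^ n) * emeasure \<nu> ?A"
      using A(1) \<nu> c by (simp add: ennreal_power suminf_ennreal2 summable_geometric)
    also have "\<dots> < \<infinity>"
      using fin[OF that] by (simp add: ennreal_mult_less_top)
    finally have "AE x in \<nu>. (\<Sum>n. ?p n x) \<noteq> \<infinity>"
      using p by (intro nn_integral_noteq_infinite) auto
    then show ?thesis
    proof (rule AE_mp[OF _ AE_I2], intro impI)
      fix x assume "x \<in> space \<nu>" and sum: "(\<Sum>n. ?p n x) \<noteq> \<infinity>"
      then have x: "x \<in> X"
        by (simp add: space_\<nu>)
      let ?H = "\<lambda>n. {\<omega> \<in> space M. iter T n x (\<lambda>i. \<xi> i \<omega>) \<in> ?A}"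
      have H: "?H n \<in> sets M" for n
        using measurable_sets[OF trajectory_measurable[OF x] A(1), of n]
        by (simp add: vimage_def Int_def conj_commute)
      have "summable (\<lambda>n. prob (?H n))"
        using sum prob_trajectory_in[OF x A(1)] by (intro summable_suminf_not_top) auto
      then have "AE \<omega> in M. eventually (\<lambda>n. \<omega> \<in> space M - ?H n) sequentially"
        using H by (intro borel_cantelli_AE1) (auto simp: emeasure_eq_measure)
      then show "AE \<omega> in M. eventually (\<lambda>n. iter T n x (\<lambda>i. \<xi> i \<omega>) \<notin> ?A) sequentially"
        by (rule AE_mp[OF _ AE_I2]) (auto elim: eventually_mono)
    qed
  qed
  have "AE x in \<nu>. \<forall>k::nat. AE \<omega> in M. eventually (\<lambda>n. iter T n x (\<lambda>i. \<xi> i \<omega>)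
      \<notin> X - nbhd0 X (inverse (real (Suc k)))) sequentially"
    unfolding AE_all_countable by (intro allI AE_eventually) simp
  then show ?thesis
  proof (rule AE_mp[OF _ AE_I2], intro impI)
    fix x assume "x \<in> space \<nu>"
    then have x: "x \<in> X"
      by (simp add: space_\<nu>)
    assume "\<forall>k::nat. AE \<omega> in M. eventually (\<lambda>n. iter T n x (\<lambda>i. \<xi> i \<omega>)
      \<notin> X - nbhd0 X (inverse (real (Suc k)))) sequentially"
    then have "AE \<omega> in M. \<forall>k::nat. eventually (\<lambda>n. iter T n x (\<lambda>i. \<xi> i \<omega>)
      \<notin> X - nbhd0 X (inverse (real (Suc k)))) sequentially"
      by (subst AE_all_countable)
    then show "AE \<omega> in M. (\<lambda>n. iter T n x (\<lambda>i. \<xi> i \<omega>)) \<longlonglongrightarrow> 0"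
    proof (rule AE_mp[OF _ AE_I2], intro impI tendstoI)
      fix \<omega> and e :: real
      assume \<omega>: "\<omega> \<in> space M" and "e > 0"
        and ev: "\<forall>k::nat. eventually (\<lambda>n. iter T n x (\<lambda>i. \<xi> i \<omega>)
          \<notin> X - nbhd0 X (inverse (real (Suc k)))) sequentially"
      obtain k where k: "inverse (real (Suc k)) < e"
        using reals_Archimedean[OF \<open>e > 0\<close>] by auto
      have in_X: "iter T n x (\<lambda>i. \<xi> i \<omega>) \<in> X" for n
        using measurable_space[OF trajectory_measurable[OF x] \<omega>] by (simp add: space_BX)
      show "eventually (\<lambda>n. dist (iter T n x (\<lambda>i. \<xi> i \<omega>)) 0 < e) sequentially"
        using ev[rule_format, of k] by (rule eventually_mono) (use in_X k in \<open>auto simp: nbhd0_def\<close>)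
    qed
  qed
qed

text \<open>
  Almost sure stability demands that the set of bad initial points be measurable, so a null set
  containing it would not be enough.
\<close>

lemma trajectory_divergence_measurable:
  "(\<lambda>x. \<P>(\<omega> in M. \<not> (\<lambda>n. iter T n x (\<lambda>i. \<xi> i \<omega>)) \<longlonglongrightarrow> 0)) \<in> borel_measurable BX"
proof -
  have [measurable]: "(\<lambda>p. iter T n (fst p) (\<lambda>i. \<xi> i (snd p))) \<in> borel_measurable (BX \<Otimes>\<^sub>M M)" for n
    using trajectory_jointly_measurable[of n] by (simp add: measurable_restrict_space2_iff)
  have "{p \<in> space (BX \<Otimes>\<^sub>M M). \<not> (\<lambda>n. iter T n (fst p) (\<lambda>i. \<xi> i (snd p))) \<longlonglongrightarrow> 0}
      \<in> sets (BX \<Otimes>\<^sub>M M)"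
    by measurable
  also have "{p \<in> space (BX \<Otimes>\<^sub>M M). \<not> (\<lambda>n. iter T n (fst p) (\<lambda>i. \<xi> i (snd p))) \<longlonglongrightarrow> 0}
      = {p \<in> space (BX \<Otimes>\<^sub>M M).
          snd p \<in> {\<omega> \<in> space M. \<not> (\<lambda>n. iter T n (fst p) (\<lambda>i. \<xi> i \<omega>)) \<longlonglongrightarrow> 0}}"
    by (auto simp: space_pair_measure)
  finally have "(\<lambda>x. emeasure M {\<omega> \<in> space M. \<not> (\<lambda>n. iter T n x (\<lambda>i. \<xi> i \<omega>)) \<longlonglongrightarrow> 0})
      \<in> borel_measurable BX"
    by (intro measurable_emeasure) auto
  then show ?thesis
    unfolding measure_def by measurable
qed

lemma ae_as_stable_if_AE_convergence:
  assumes \<nu>: "sets \<nu> = sets BX"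
    and conv: "AE x in \<nu>. AE \<omega> in M. (\<lambda>n. iter T n x (\<lambda>i. \<xi> i \<omega>)) \<longlonglongrightarrow> 0"
  shows "ae_as_stable M X T \<xi> \<nu>"
  unfolding ae_as_stable_def
proof (intro allI impI)
  fix \<delta> :: real assume "\<delta> > 0"
  let ?p = "\<lambda>x. \<P>(\<omega> in M. \<not> (\<lambda>n. iter T n x (\<lambda>i. \<xi> i \<omega>)) \<longlonglongrightarrow> 0)"
  have space_\<nu>: "space \<nu> = X"
    using sets_eq_imp_space_eq[OF \<nu>] by (simp add: space_BX)
  have [measurable]: "?p \<in> borel_measurable \<nu>"
    using trajectory_divergence_measurable by (simp add: measurable_cong_sets[OF \<nu> refl])
  have "AE x in \<nu>. \<not> \<delta> \<le> ?p x"
    using conv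
  proof (rule AE_mp[OF _ AE_I2], intro impI)
    fix x assume "AE \<omega> in M. (\<lambda>n. iter T n x (\<lambda>i. \<xi> i \<omega>)) \<longlonglongrightarrow> 0"
    then have "?p x = 0"
      by (cases "{\<omega> \<in> space M. \<not> (\<lambda>n. iter T n x (\<lambda>i. \<xi> i \<omega>)) \<longlonglongrightarrow> 0} \<in> sets M")
        (simp_all add: prob_Collect_eq_0 measure_notin_sets)
    with \<open>\<delta> > 0\<close> show "\<not> \<delta> \<le> ?p x"
      by simp
  qed
  moreover have "{x \<in> space \<nu>. \<not> \<not> \<delta> \<le> ?p x} \<in> sets \<nu>"
    by measurable
  ultimately show "{x \<in> X. \<delta> \<le> ?p x} \<in> null_sets \<nu>"
    by (simp add: AE_iff_null space_\<nu>)
qed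

section \<open>Geometric decay\<close>

text \<open>
  With \<open>a\<^sup>2 = c\<close>, Markov's inequality at level \<open>a\<^sup>n\<close> turns the bound \<open>c\<^sup>n\<close> on the integral into
  the bound \<open>c\<^sup>n / a\<^sup>n = a\<^sup>n\<close> on the measure. The constant is uniform in
  \<open>B\<close> because \<open>\<nu>(B)\<close> is bounded by \<open>\<nu>(X - U(\<epsilon>))\<close>.
\<close>

lemma geometric_decay_of_domination:
  assumes eq: "equilibrium v T"
    and \<nu>: "sets \<nu> = sets BX"
    and contr: "\<And>B. B \<in> sets BX \<Longrightarrow> 0 \<notin> B \<Longrightarrow>
      (\<integral>\<^sup>+ x. koopman v T (indicator B) x \<partial>\<nu>) \<le> ennreal c * emeasure \<nu> B"
    and c: "0 < c" "c < 1"
    and fin: "\<And>\<epsilon>. \<epsilon> > 0 \<Longrightarrow> emeasure \<nu> (X - nbhd0 X \<epsilon>) < \<infinity>"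
    and m: "sets m = sets BX"
    and \<kappa>: "\<kappa> > 0" "\<And>B. B \<in> sets BX \<Longrightarrow> emeasure m B \<le> ennreal \<kappa> * emeasure \<nu> B"
  shows "ae_stochastic_stable_geometric M X T \<xi> m"
  unfolding ae_stochastic_stable_geometric_def
proof (intro allI impI)
  fix \<epsilon> :: real assume \<epsilon>: "\<epsilon> > 0"
  have space_\<nu>: "space \<nu> = X"
    using sets_eq_imp_space_eq[OF \<nu>] by (simp add: space_BX)
  let ?A = "X - nbhd0 X \<epsilon>"
  define a where "a = sqrt c"
  have a: "0 < a" "a < 1" "a * a = c"
    using c by (auto simp: a_def)
  define K where "K = \<kappa> * measure \<nu> ?A"
  have K: "ennreal \<kappa> * emeasure \<nu> ?A = ennreal K"
    using fin[OF \<epsilon>] \<kappa>(1) by (simp add: K_def ennreal_mult emeasure_eq_ennreal_measure)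
  have bound: "{x \<in> X. a ^ n \<le> \<P>(\<omega> in M. iter T n x (\<lambda>i. \<xi> i \<omega>) \<in> B)} \<in> sets m \<and>
      emeasure m {x \<in> X. a ^ n \<le> \<P>(\<omega> in M. iter T n x (\<lambda>i. \<xi> i \<omega>) \<in> B)} \<le> ennreal (K * a ^ n)"
    if "B \<in> sets (restrict_space borel ?A)" for n B
  proof -
    let ?p = "\<lambda>x. \<integral>\<^sup>+ \<omega>. indicator B (iter T n x (\<lambda>i. \<xi> i \<omega>)) \<partial>M"
    let ?S = "{x \<in> X. a ^ n \<le> \<P>(\<omega> in M. iter T n x (\<lambda>i. \<xi> i \<omega>) \<in> B)}"
    have "?A \<in> sets borel"
      using outside_nbhd0_measurable by (simp add: sets_BX_iff)
    with that have BA: "B \<subseteq> ?A" and "B \<in> sets borel"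
      by (simp_all add: sets_restrict_space_iff)
    then have B: "B \<in> sets BX" "0 \<notin> B"
      using \<epsilon> zero_in_X by (auto simp: sets_BX_iff nbhd0_def)
    have p: "?p \<in> borel_measurable BX"
      using B(1) by (intro expectation_trajectory_measurable) simp
    have p\<nu>[measurable]: "?p \<in> borel_measurable \<nu>"
      using p by (simp add: measurable_cong_sets[OF \<nu> refl])
    have S_eq: "?S = {x \<in> space \<nu>. 1 \<le> ennreal (1 / a ^ n) * ?p x}"
    proof -
      have "(a ^ n \<le> \<P>(\<omega> in M. iter T n x (\<lambda>i. \<xi> i \<omega>) \<in> B)) \<longleftrightarrow> 1 \<le> ennreal (1 / a ^ n) * ?p x"
        if "x \<in> X" for x
        using a(1) unfolding prob_trajectory_in[OF that B(1)]
        by (simp add: ennreal_mult[symmetric] ennreal_1[symmetric] field_simps del: ennreal_1)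
      then show ?thesis
        by (auto simp: space_\<nu>)
    qed
    have S: "?S \<in> sets \<nu>"
      unfolding S_eq by measurable
    have "emeasure m ?S \<le> ennreal \<kappa> * emeasure \<nu> ?S"
      using S \<nu> by (intro \<kappa>(2)) simp
    also have "emeasure \<nu> ?S \<le> ennreal (1 / a ^ n) * (\<integral>\<^sup>+ x. ?p x * indicator (space \<nu>) x \<partial>\<nu>)"
      unfolding S_eq by (rule nn_integral_Markov_inequality) auto
    also have "(\<integral>\<^sup>+ x. ?p x * indicator (space \<nu>) x \<partial>\<nu>) = (\<integral>\<^sup>+ x. ?p x \<partial>\<nu>)"
      by (intro nn_integral_cong) simp
    also have "\<dots> \<le> ennreal c ^ n * (\<integral>\<^sup>+ x. indicator B x \<partial>\<nu>)"
      using B by (intro expectation_decay[OF eq \<nu> contr]) auto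
    also have "\<dots> \<le> ennreal c ^ n * emeasure \<nu> ?A"
      using B(1) BA outside_nbhd0_measurable \<nu> by (auto intro!: mult_left_mono emeasure_mono)
    also have "ennreal \<kappa> * (ennreal (1 / a ^ n) * (ennreal c ^ n * emeasure \<nu> ?A))
        = (ennreal (1 / a ^ n) * ennreal c ^ n) * (ennreal \<kappa> * emeasure \<nu> ?A)"
      by (simp add: ac_simps)
    also have "ennreal (1 / a ^ n) * ennreal c ^ n = ennreal (a ^ n)"
      using a(1) by (simp add: a(3)[symmetric] ennreal_power ennreal_mult[symmetric] power_mult_distrib)
    also have "ennreal (a ^ n) * (ennreal \<kappa> * emeasure \<nu> ?A) = ennreal (K * a ^ n)"
      using a(1) \<kappa>(1) unfolding K by (simp add: K_def ennreal_mult[symmetric] mult.commute)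
    finally have "emeasure m ?S \<le> ennreal (K * a ^ n)"
      by (simp add: mult_left_mono)
    with S \<nu> m show ?thesis
      by simp
  qed
  show "\<exists>\<alpha> \<beta> K :: real. 0 < \<alpha> \<and> \<alpha> < 1 \<and> 0 < \<beta> \<and> \<beta> < 1 \<and>
      (\<forall>n. \<forall>B\<in>sets (restrict_space borel ?A). emeasure m B > 0 \<longrightarrow>
        (let S = {x\<in>X. \<P>(\<omega> in M. iter T n x (\<lambda>i. \<xi> i \<omega>) \<in> B) \<ge> \<alpha> ^ n}
         in S \<in> sets m \<and> emeasure m S \<le> ennreal (K * \<beta> ^ n)))"
    unfolding Let_def
    by (rule exI[of _ a], rule exI[of _ a], rule exI[of _ K]) (use a bound in blast)
qed

section \<open>The Lyapunov measure\<close>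

lemma inclusion_measurable:
  assumes "sets m = sets (restrict_space borel (X - {0}))"
  shows "(\<lambda>x. x) \<in> m \<rightarrow>\<^sub>M BX"
proof -
  have "(\<lambda>x. x) \<in> restrict_space borel (X - {0}) \<rightarrow>\<^sub>M BX"
    by (intro measurable_restrict_space2 measurable_restrict_space1)
      (auto simp: space_restrict_space)
  then show ?thesis
    by (simp add: measurable_cong_sets[OF assms refl])
qed

lemma space_punctured:
  assumes "sets m = sets (restrict_space borel (X - {0}))"
  shows "space m = X - {0}"
  using sets_eq_imp_space_eq[OF assms] by (simp add: space_restrict_space)

lemma sets_extend_by_zero: "sets (extend_by_zero X m) = sets BX"
  by (simp add: extend_by_zero_def)

lemma emeasure_extend_by_zero:
  assumes "sets m = sets (restrict_space borel (X - {0}))" "B \<in> sets BX"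
  shows "emeasure (extend_by_zero X m) B = emeasure m (B - {0})"
proof -
  have "emeasure (extend_by_zero X m) B = emeasure m ((\<lambda>x. x) -` B \<inter> space m)"
    unfolding extend_by_zero_def by (rule emeasure_distr[OF inclusion_measurable[OF assms(1)] assms(2)])
  also have "(\<lambda>x. x) -` B \<inter> space m = B - {0}"
    using assms(2) by (auto simp: space_punctured[OF assms(1)] sets_BX_iff)
  finally show ?thesis .
qed

text \<open>
  The defining inequality of a Lyapunov measure covers only Borel sets that avoid some ball around
  \<open>0\<close>, whereas one application of the Koopman operator may already lead to functions that are positive
  arbitrarily close to \<open>0\<close>. So it is extended to all Borel sets without \<open>0\<close>, as a limit over shrinking
  balls.
\<close>

lemma lyapunov_contraction:
  assumes L: "lyapunov_measure X v T \<gamma> \<mu>" and B: "B \<in> sets BX" "0 \<notin> B"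
  shows "(\<integral>\<^sup>+ x. koopman v T (indicator B) x \<partial>(extend_by_zero X \<mu>))
       \<le> ennreal \<gamma> * emeasure (extend_by_zero X \<mu>) B"
proof -
  interpret v: prob_space v
    by (rule prob_space_v)
  let ?\<nu> = "extend_by_zero X \<mu>"
  have \<mu>: "sets \<mu> = sets (restrict_space borel (X - {0}))"
    using L by (simp add: lyapunov_measure_def)
  \<comment> \<open>\<open>Q\<close> is the image of \<open>\<nu>\<close> under one step of the system, as a measure, so that continuity from below
    applies to it.\<close>
  define Q where "Q = distr (?\<nu> \<Otimes>\<^sub>M v) BX (\<lambda>p. T (fst p) (snd p))"
  have T_\<nu>: "(\<lambda>p. T (fst p) (snd p)) \<in> ?\<nu> \<Otimes>\<^sub>M v \<rightarrow>\<^sub>M BX"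
    using T_jointly_measurable
    by (simp add: measurable_cong_sets[OF sets_pair_measure_cong[OF sets_extend_by_zero refl] refl])
  have Q: "emeasure Q C = (\<integral>\<^sup>+ x. koopman v T (indicator C) x \<partial>?\<nu>)" if "C \<in> sets BX" for C
  proof -
    have "emeasure Q C = (\<integral>\<^sup>+ y. indicator C y \<partial>Q)"
      using that by (simp add: Q_def)
    also have "\<dots> = (\<integral>\<^sup>+ p. indicator C (T (fst p) (snd p)) \<partial>(?\<nu> \<Otimes>\<^sub>M v))"
      unfolding Q_def using that by (intro nn_integral_distr[OF T_\<nu>]) simp
    also have "\<dots> = (\<integral>\<^sup>+ x. \<integral>\<^sup>+ w. indicator C (T (fst (x, w)) (snd (x, w))) \<partial>v \<partial>?\<nu>)"
      using that by (intro v.nn_integral_fst[symmetric] measurable_compose[OF T_\<nu>]) simp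
    finally show ?thesis
      by (simp add: koopman_def)
  qed
  have P1_eq: "P1 v T \<mu> C = emeasure Q C" if "C \<in> sets BX" for C
  proof -
    have "P1 v T \<mu> C = (\<integral>\<^sup>+ x. koopman v T (indicator C) x \<partial>\<mu>)"
      by (simp add: P1_def koopman_def)
    also have "\<dots> = (\<integral>\<^sup>+ x. koopman v T (indicator C) x \<partial>?\<nu>)"
      unfolding extend_by_zero_def using that
      by (intro nn_integral_distr[symmetric] inclusion_measurable[OF \<mu>])
        (simp add: koopman_measurable)
    finally show ?thesis
      by (simp add: Q[OF that])
  qed
  define C where "C k = B \<inter> (X - nbhd0 X (inverse (real (Suc k))))" for k
  have C: "C k \<in> sets BX" for k
    unfolding C_def by (intro sets.Int B outside_nbhd0_measurable)
  have step: "emeasure Q (C k) \<le> ennreal \<gamma> * emeasure ?\<nu> (C k)" for k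
  proof -
    let ?A = "X - nbhd0 X (inverse (real (Suc k)))"
    have pos: "inverse (real (Suc k)) > 0"
      by simp
    have "?A \<in> sets borel"
      using outside_nbhd0_measurable by (simp add: sets_BX_iff)
    with C[of k] have "C k \<in> sets (restrict_space borel ?A)"
      by (simp add: sets_restrict_space_iff sets_BX_iff C_def)
    then have "(emeasure \<mu> (C k) > 0 \<longrightarrow> P1 v T \<mu> (C k) < ennreal \<gamma> * emeasure \<mu> (C k)) \<and>
        (emeasure \<mu> (C k) = 0 \<longrightarrow> P1 v T \<mu> (C k) = 0)"
      using L pos unfolding lyapunov_measure_def by blast
    then have "P1 v T \<mu> (C k) \<le> ennreal \<gamma> * emeasure \<mu> (C k)"
      by (cases "emeasure \<mu> (C k) = 0") (auto simp: zero_less_iff_neq_zero intro: less_imp_le)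
    moreover have "C k - {0} = C k"
      using B(2) by (auto simp: C_def)
    ultimately show ?thesis
      using P1_eq[OF C] emeasure_extend_by_zero[OF \<mu> C, of k] by simp
  qed
  have "incseq C"
  proof (rule incseq_SucI)
    fix k
    have "inverse (real (Suc (Suc k))) \<le> inverse (real (Suc k))"
      by (rule le_imp_inverse_le) auto
    then have "ball (0 :: 'a) (inverse (real (Suc (Suc k)))) \<subseteq> ball 0 (inverse (real (Suc k)))"
      by (rule subset_ball)
    then show "C k \<le> C (Suc k)"
      unfolding C_def nbhd0_def by blast
  qed
  moreover have "(\<Union>k. C k) = B"
  proof
    show "B \<subseteq> (\<Union>k. C k)"
    proof
      fix x assume "x \<in> B"
      with B have "norm x > 0" "x \<in> X"
        by (auto simp: sets_BX_iff)
      then obtain k where "inverse (real (Suc k)) < norm x"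
        using reals_Archimedean by blast
      with \<open>x \<in> B\<close> \<open>x \<in> X\<close> show "x \<in> (\<Union>k. C k)"
        by (auto simp: C_def nbhd0_def intro!: exI[of _ k])
    qed
  qed (auto simp: C_def)
  moreover have "range C \<subseteq> sets Q"
    using C by (auto simp: Q_def)
  ultimately have "emeasure Q B = (SUP k. emeasure Q (C k))"
    using SUP_emeasure_incseq by metis
  also have "\<dots> \<le> ennreal \<gamma> * emeasure ?\<nu> B"
    using B(1)
    by (intro SUP_least order_trans[OF step] mult_left_mono emeasure_mono)
      (auto simp: C_def sets_extend_by_zero)
  finally show ?thesis
    by (simp add: Q[OF B(1)])
qed

lemma lyapunov_finite_outside_nbhd0:
  assumes "lyapunov_measure X v T \<gamma> \<mu>" "\<epsilon> > 0"
  shows "emeasure (extend_by_zero X \<mu>) (X - nbhd0 X \<epsilon>) < \<infinity>"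
proof -
  have "X - nbhd0 X \<epsilon> - {0} = X - nbhd0 X \<epsilon>"
    using \<open>\<epsilon> > 0\<close> by (auto simp: nbhd0_def)
  with assms show ?thesis
    by (simp add: lyapunov_measure_def emeasure_extend_by_zero outside_nbhd0_measurable)
qed

lemma punctured_measurable:
  assumes "B \<in> sets BX"
  shows "B - {0} \<in> sets (restrict_space borel (X - {0}))"
proof -
  have "X - {0} \<in> sets borel"
    using compact_X by (intro sets.Diff borel_closed compact_imp_closed) auto
  with assms show ?thesis
    by (auto simp: sets_restrict_space_iff sets_BX_iff)
qed

end

theorem theorem16:
  fixes M :: "'p measure"
    and X :: "'a::euclidean_space set"
    and v :: "'w measure"
    and T :: "'a \<Rightarrow> 'w \<Rightarrow> 'a"
    and \<xi> :: "nat \<Rightarrow> 'p \<Rightarrow> 'w"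
    and \<mu> :: "'a measure"
    and \<gamma> :: real
  assumes "stochastic_system M X v T \<xi>"
    and "equilibrium v T"
    and "locally_stable M X T \<xi>"
    and "lyapunov_measure X v T \<gamma> \<mu>"
    and "\<gamma> < 1"
  shows "(\<forall>m :: 'a measure.
            finite_measure m \<longrightarrow>
            sets m = sets (restrict_space borel (X - {0})) \<longrightarrow>
            absolutely_continuous \<mu> m \<longrightarrow>
            ae_as_stable M X T \<xi> (extend_by_zero X m))
       \<and> (\<forall>m :: 'a measure.
            finite_measure m \<longrightarrow>
            sets m = sets (restrict_space borel (X - {0})) \<longrightarrow>
            (\<exists>\<kappa>::real. \<kappa> > 0 \<and>
              (\<forall>B\<in>sets (restrict_space borel (X - {0})).
                emeasure m B \<le> ennreal \<kappa> * emeasure \<mu> B)) \<longrightarrow>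
            ae_stochastic_stable_geometric M X T \<xi> (extend_by_zero X m))"
proof -
  interpret stochastic_system M X v T \<xi>
    by (rule assms(1))
  note eq = assms(2) and L = assms(4)
  let ?\<nu> = "extend_by_zero X \<mu>"
  have \<gamma>: "0 < \<gamma>" and \<mu>: "sets \<mu> = sets (restrict_space borel (X - {0}))"
    using L by (simp_all add: lyapunov_measure_def)
  note contr = lyapunov_contraction[OF L] and fin = lyapunov_finite_outside_nbhd0[OF L]
  show ?thesis
  proof (intro conjI allI impI)
    fix m :: "'a measure"
    assume m: "sets m = sets (restrict_space borel (X - {0}))" and ac: "absolutely_continuous \<mu> m"
    have "ae_as_stable M X T \<xi> ?\<nu>"
      using eq contr \<gamma> assms(5) fin
      by (intro ae_as_stable_if_AE_convergence AE_convergence[where c = \<gamma>] sets_extend_by_zero) auto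
    moreover have "null_sets ?\<nu> \<subseteq> null_sets (extend_by_zero X m)"
      using ac unfolding extend_by_zero_def absolutely_continuous_def
      by (auto simp: null_sets_distr_iff[OF inclusion_measurable[OF \<mu>]]
          null_sets_distr_iff[OF inclusion_measurable[OF m]] space_punctured[OF \<mu>] space_punctured[OF m])
    ultimately show "ae_as_stable M X T \<xi> (extend_by_zero X m)"
      unfolding ae_as_stable_def by blast
  next
    fix m :: "'a measure"
    assume m: "sets m = sets (restrict_space borel (X - {0}))"
    assume "\<exists>\<kappa>::real. \<kappa> > 0 \<and> (\<forall>B\<in>sets (restrict_space borel (X - {0})).
      emeasure m B \<le> ennreal \<kappa> * emeasure \<mu> B)"
    then obtain \<kappa> :: real where \<kappa>: "\<kappa> > 0"
      "\<And>B. B \<in> sets (restrict_space borel (X - {0})) \<Longrightarrow> emeasure m B \<le> ennreal \<kappa> * emeasure \<mu> B"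
      by blast
    have "emeasure (extend_by_zero X m) B \<le> ennreal \<kappa> * emeasure ?\<nu> B" if "B \<in> sets BX" for B
      using \<kappa>(2)[OF punctured_measurable[OF that]] that
      by (simp add: emeasure_extend_by_zero m \<mu>)
    then show "ae_stochastic_stable_geometric M X T \<xi> (extend_by_zero X m)"
      using eq contr \<gamma> assms(5) fin \<kappa>(1)
      by (intro geometric_decay_of_domination[where \<nu> = ?\<nu> and c = \<gamma> and \<kappa> = \<kappa>] sets_extend_by_zero) auto
  qed
qed

end
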